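(* Let $G$ be a DAG whose nodes are discrete random variables, let the joint distribution $P$ be Markovian with respect to $G$ (with given causal conditionals), and let $X\to Y$ be an arrow of $G$. Then $$\mathfrak{C}_{X\to Y}\ \ge\ I\bigl(X;Y\,|\,PA_Y^X\bigr),$$ where $PA_Y^X$ denotes the set of all parents of $Y$ in $G$ other than $X$ and $\mathfrak{C}_{X\to Y}$ is the causal strength of the arrow $X\to Y$.
   Context: Denote the nodes by $X_1,\dots,X_n$ (discrete random variables), with joint probability mass function $P(x_1,\dots,x_n)$, and let $PA_j$ be the set of parents of $X_j$ in $G$, with values $pa_j$. $P$ is Markovian with respect to $G$ if $P(x_1,\dots,x_n)=\prod_{j=1}^n P(x_j|pa_j)$. The causal conditionals $P(X_j|pa_j)$ are assumed to be given (as probability distributions) also for those $pa_j$ with $P(pa_j)=0$. For a set $S$ of arrows of $G$, $PA_j^S$ is the set of parents $X_i$ of $X_j$ with $(X_i\to X_j)\in S$ and $PA_j^{\bar S}$ is the set of the remaining parents of $X_j$; values are written $pa_j^S$, $pa_j^{\bar S}$. Define $$P_S(x_j|pa_j^{\bar S}):=\sum_{pa_j^S}P(x_j|pa_j^{\bar S},pa_j^S)\,P_{\prod}(pa_j^S),$$ where $P_{\prod}(pa_j^S)$ is the product of the marginal distributions (under $P$) of all variables in $PA_j^S$ (if $PA_j^S=\emptyset$ this is just $P(x_j|pa_j)$), and the interventional distribution $P_S(x_1,\dots,x_n):=\prod_j P_S(x_j|pa_j^{\bar S})$. The causal strength of $S$ is the Kullback–Leibler divergence $\mathfrak{C}_S(P):=D(P\|P_S)$;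 for a single arrow $S=\{X\to Y\}$ one writes $\mathfrak{C}_{X\to Y}$. Conditional mutual information (under $P$): $I(X;Y|Z):=\sum_{x,y,z}P(x,y,z)\log\frac{P(x,y|z)}{P(x|z)P(y|z)}$, where $Z$ may be a set of variables. *)

theory Defs
  imports "HOL-Probability.Probability"
begin

section \<open>Causal networks over discrete variables\<close>

text \<open>
  The nodes are the elements of a finite type, the graph is its set of arrows, and a joint
  distribution is a probability mass function on assignments of values to the nodes. The value
  type is an arbitrary common supertype of the (finite or countable) alphabets of the nodes.
  An assignment of values to a set \<open>A\<close> of nodes is a function that is \<open>undefined\<close> outside \<open>A\<close>,
  such as \<^term>\<open>restrict x A\<close>.
\<close>

definition parents :: "('n \<times> 'n) set \<Rightarrow> 'n \<Rightarrow> 'n set" where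
  "parents E j = {i. (i, j) \<in> E}"

definition node_cond :: "('n \<times> 'n) set \<Rightarrow> ('n \<Rightarrow> 'v) pmf \<Rightarrow> 'n \<Rightarrow> ('n \<Rightarrow> 'v) \<Rightarrow> 'v \<Rightarrow> real" where
  "node_cond E P j pa v = \<P>(\<omega> in measure_pmf P. \<omega> j = v \<bar> restrict \<omega> (parents E j) = pa)"

text \<open>Where \<open>P(pa\<^sub>j) = 0\<close> the factor below is \<open>0 / 0 = 0\<close>, and \<open>P x = 0\<close> as well.\<close>

definition markovian :: "('n::finite \<times> 'n) set \<Rightarrow> ('n \<Rightarrow> 'v) pmf \<Rightarrow> bool" where
  "markovian E P \<longleftrightarrow>
     (\<forall>x. pmf P x = (\<Prod>j\<in>UNIV. node_cond E P j (restrict x (parents E j)) (x j)))"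

text \<open>
  \<open>K j pa\<close> is the distribution of node \<open>j\<close> given the values \<open>pa\<close> of its parents. It is determined
  by \<open>P\<close> where \<open>pa\<close> has positive probability, and is an arbitrary distribution elsewhere.
\<close>

definition causal_conditionals ::
  "('n \<times> 'n) set \<Rightarrow> ('n \<Rightarrow> 'v) pmf \<Rightarrow> ('n \<Rightarrow> ('n \<Rightarrow> 'v) \<Rightarrow> 'v pmf) \<Rightarrow> bool" where
  "causal_conditionals E P K \<longleftrightarrow>
     (\<forall>j pa. \<P>(\<omega> in measure_pmf P. restrict \<omega> (parents E j) = pa) > 0 \<longrightarrow>
        (\<forall>v. pmf (K j pa) v = node_cond E P j pa v))"

section \<open>Cutting arrows\<close>

definition product_of_marginals :: "('n \<Rightarrow> 'v) pmf \<Rightarrow> 'n set \<Rightarrow> ('n \<Rightarrow> 'v) pmf" where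
  "product_of_marginals P A = Pi_pmf A undefined (\<lambda>i. map_pmf (\<lambda>\<omega>. \<omega> i) P)"

text \<open>
  For a set \<open>S\<close> of arrows of \<open>E\<close>, the parents of \<open>j\<close> through \<open>S\<close> are \<^term>\<open>parents S j\<close> and the
  remaining ones are \<^term>\<open>parents (E - S) j\<close>. The argument \<open>pa\<close> below assigns values to the
  latter, \<open>s\<close> to the former.
\<close>

definition cut_cond ::
  "('n \<Rightarrow> 'v) pmf \<Rightarrow> ('n \<Rightarrow> ('n \<Rightarrow> 'v) \<Rightarrow> 'v pmf) \<Rightarrow> ('n \<times> 'n) set
    \<Rightarrow> 'n \<Rightarrow> ('n \<Rightarrow> 'v) \<Rightarrow> 'v pmf" where
  "cut_cond P K S j pa =
     bind_pmf (product_of_marginals P (parents S j)) (\<lambda>s. K j (override_on pa s (parents S j)))"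

definition interventional ::
  "('n::finite \<times> 'n) set \<Rightarrow> ('n \<Rightarrow> 'v) pmf \<Rightarrow> ('n \<Rightarrow> ('n \<Rightarrow> 'v) \<Rightarrow> 'v pmf) \<Rightarrow> ('n \<times> 'n) set
    \<Rightarrow> ('n \<Rightarrow> 'v) pmf" where
  "interventional E P K S =
     embed_pmf (\<lambda>x. \<Prod>j\<in>UNIV. pmf (cut_cond P K S j (restrict x (parents (E - S) j))) (x j))"

text \<open>For an acyclic graph the product is indeed a probability mass function.\<close>

lemma acyclic_sink:
  assumes "finite A" "A \<noteq> {}" "acyclic (E :: ('n::finite \<times> 'n) set)"
  obtains m where "m \<in> A" "\<And>j. j \<in> A \<Longrightarrow> (m, j) \<notin> E"
proof -
  have "wf (E\<inverse>)" using assms(3) by (simp add: finite_acyclic_wf_converse)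
  then obtain m where "m \<in> A" "\<And>y. (y, m) \<in> E\<inverse> \<Longrightarrow> y \<notin> A"
    using assms(2) by (metis ex_in_conv wfE_min)
  then show thesis using that by blast
qed

lemma acyclic_factors_joint:
  fixes E :: "('n::finite \<times> 'n) set" and q :: "'n \<Rightarrow> ('n \<Rightarrow> 'v) \<Rightarrow> 'v pmf"
  assumes "acyclic E" and "\<And>j i. j \<in> A \<Longrightarrow> i \<in> parents E j \<Longrightarrow> i \<in> A"
  shows "\<exists>R. \<forall>x. pmf R x =
    (if x \<in> extensional A then \<Prod>j\<in>A. pmf (q j (restrict x (parents E j))) (x j) else 0)"
  using assms(2)
proof (induction "card A" arbitrary: A)
  case 0
  then have "A = {}" by simp
  then have "\<forall>x. pmf (return_pmf (\<lambda>_. undefined)) x =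
    (if x \<in> extensional A then \<Prod>j\<in>A. pmf (q j (restrict x (parents E j))) (x j) else 0)"
    by (auto simp: extensional_def indicator_def)
  then show ?case by blast
next
  case (Suc n)
  then have "A \<noteq> {}" by auto
  then obtain m where m: "m \<in> A" "\<And>j. j \<in> A \<Longrightarrow> (m, j) \<notin> E"
    using acyclic_sink[OF finite _ assms(1)] by blast
  define B where "B = A - {m}"
  have A: "A = insert m B" "m \<notin> B" using m by (auto simp: B_def)
  have "n = card B" using Suc.hyps(2) A by simp
  moreover have "\<And>j i. j \<in> B \<Longrightarrow> i \<in> parents E j \<Longrightarrow> i \<in> B"
    using Suc.prems m by (auto simp: B_def parents_def)
  ultimately obtain R where R: "\<And>x. pmf R x =
    (if x \<in> extensional B then \<Prod>j\<in>B. pmf (q j (restrict x (parents E j))) (x j) else 0)"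
    using Suc.hyps(1)[of B] by blast
  define Q where "Q = bind_pmf R (\<lambda>y. map_pmf (\<lambda>v. y(m := v)) (q m (restrict y (parents E m))))"
  have ext: "set_pmf R \<subseteq> extensional B"
    using R by (auto simp: set_pmf_eq split: if_splits)
  have "pmf Q x =
    (if x \<in> extensional A then \<Prod>j\<in>A. pmf (q j (restrict x (parents E j))) (x j) else 0)" for x
  proof -
    define y0 where "y0 = x(m := undefined)"
    have inner: "pmf (map_pmf (\<lambda>v. y(m := v)) (q m (restrict y (parents E m)))) x =
       (if x \<in> extensional A then pmf (q m (restrict y0 (parents E m))) (x m) else 0) *
       indicator {y0} y" if "y \<in> set_pmf R" for y
    proof -
      have y: "y \<in> extensional B" using that ext by auto
      then have ym: "y m = undefined" using A by (auto simp: extensional_def)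
      have inj: "inj (\<lambda>v. y(m := v))" by (rule injI) (metis fun_upd_same)
      show ?thesis
      proof (cases "y = y0")
        case True
        then have "x \<in> extensional A" "x = y(m := x m)"
          using y A by (auto simp: y0_def extensional_def fun_eq_iff)
        then show ?thesis
          using pmf_map_inj'[OF inj, of "q m (restrict y (parents E m))" "x m"] True by simp
      next
        case False
        then have "x \<notin> range (\<lambda>v. y(m := v))"
          using ym by (auto simp: y0_def)
        then have "x \<notin> set_pmf (map_pmf (\<lambda>v. y(m := v)) (q m (restrict y (parents E m))))"
          by auto
        then show ?thesis using False unfolding set_pmf_iff by simp
      qed
    qed
    have "pmf Q x = (\<integral>y. (if x \<in> extensional A
        then pmf (q m (restrict y0 (parents E m))) (x m) else 0) * indicator {y0} y \<partial>measure_pmf R)"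
      unfolding Q_def pmf_bind by (intro integral_cong_AE) (auto simp: AE_measure_pmf_iff inner)
    also have "\<dots> = (if x \<in> extensional A
        then pmf (q m (restrict y0 (parents E m))) (x m) else 0) * pmf R y0"
      by (simp add: pmf.rep_eq)
    also have "\<dots> = (if x \<in> extensional A
        then \<Prod>j\<in>A. pmf (q j (restrict x (parents E j))) (x j) else 0)"
    proof (cases "x \<in> extensional A")
      case True
      have r: "restrict y0 (parents E j) = restrict x (parents E j)" if "j \<in> A" for j
        using m(2)[OF that] by (auto simp: y0_def restrict_def parents_def fun_eq_iff)
      have "y0 \<in> extensional B" using True A by (auto simp: y0_def extensional_def)
      moreover have "(\<Prod>j\<in>B. pmf (q j (restrict y0 (parents E j))) (y0 j)) =
        (\<Prod>j\<in>B. pmf (q j (restrict x (parents E j))) (x j))"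
        using A r by (intro prod.cong) (auto simp: y0_def)
      ultimately show ?thesis using True A r[OF m(1)] by (simp add: R)
    qed simp
    finally show ?thesis .
  qed
  then show ?case by blast
qed

lemma pmf_interventional:
  fixes E :: "('n::finite \<times> 'n) set"
  assumes "acyclic E"
  shows "pmf (interventional E P K S) x =
    (\<Prod>j\<in>UNIV. pmf (cut_cond P K S j (restrict x (parents (E - S) j))) (x j))"
proof -
  have "acyclic (E - S)" using assms by (rule acyclic_subset) auto
  from acyclic_factors_joint[OF this, of UNIV "cut_cond P K S"]
  obtain R where R: "pmf R =
      (\<lambda>x. \<Prod>j\<in>UNIV. pmf (cut_cond P K S j (restrict x (parents (E - S) j))) (x j))"
    by (auto simp: fun_eq_iff)
  have "interventional E P K S = R"
    unfolding interventional_def R[symmetric]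
    by (rule type_definition.Rep_inverse[OF td_pmf_embed_pmf])
  then show ?thesis by (simp add: R)
qed

section \<open>Information quantities\<close>

text \<open>
  The negative part of each of the two sums below always converges, so that a sum that does not
  converge absolutely has the value \<open>\<infinity>\<close>; this can happen for countably infinite alphabets.
  The library's \<^const>\<open>KL_divergence\<close> has the reference measure as its first argument.
\<close>

definition relative_entropy :: "real \<Rightarrow> 'a pmf \<Rightarrow> 'a pmf \<Rightarrow> ereal" where
  "relative_entropy b P Q =
     (if absolutely_continuous (measure_pmf Q) (measure_pmf P) \<and>
         integrable (measure_pmf P) (entropy_density b (measure_pmf Q) (measure_pmf P))
      then ereal (KL_divergence b (measure_pmf Q) (measure_pmf P)) else \<infinity>)"

definition cond_mutual_info_term ::
  "real \<Rightarrow> 'a pmf \<Rightarrow> ('a \<Rightarrow> 'x) \<Rightarrow> ('a \<Rightarrow> 'y) \<Rightarrow> ('a \<Rightarrow> 'z) \<Rightarrow> 'x \<times> 'y \<times> 'z \<Rightarrow> real" where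
  "cond_mutual_info_term b P X Y Z = (\<lambda>(x, y, z).
     \<P>(\<omega> in measure_pmf P. X \<omega> = x \<and> Y \<omega> = y \<and> Z \<omega> = z) *
     log b (\<P>(\<omega> in measure_pmf P. X \<omega> = x \<and> Y \<omega> = y \<bar> Z \<omega> = z) /
       (\<P>(\<omega> in measure_pmf P. X \<omega> = x \<bar> Z \<omega> = z) * \<P>(\<omega> in measure_pmf P. Y \<omega> = y \<bar> Z \<omega> = z))))"

definition cond_mutual_info ::
  "real \<Rightarrow> 'a pmf \<Rightarrow> ('a \<Rightarrow> 'x) \<Rightarrow> ('a \<Rightarrow> 'y) \<Rightarrow> ('a \<Rightarrow> 'z) \<Rightarrow> ereal" where
  "cond_mutual_info b P X Y Z =
     (if cond_mutual_info_term b P X Y Z summable_on UNIV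
      then ereal (\<Sum>\<^sub>\<infinity>t\<in>UNIV. cond_mutual_info_term b P X Y Z t) else \<infinity>)"

definition causal_strength ::
  "real \<Rightarrow> ('n::finite \<times> 'n) set \<Rightarrow> ('n \<Rightarrow> 'v) pmf \<Rightarrow> ('n \<Rightarrow> ('n \<Rightarrow> 'v) \<Rightarrow> 'v pmf)
    \<Rightarrow> ('n \<times> 'n) set \<Rightarrow> ereal" where
  "causal_strength b E P K S = relative_entropy b P (interventional E P K S)"

end

theory Submission
  imports Defs
begin

text \<open>
  Let \<open>Z\<close> be the parents of \<open>Y\<close> other than \<open>X\<close>, and let \<open>Q(y|z)\<close> be the conditional of \<open>Y\<close>
  after cutting \<open>X \<rightarrow> Y\<close>. All factors of \<open>P\<close> and \<open>P\<^sub>S\<close> except those of \<open>Y\<close> agree, so the causal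
  strength is the expectation of \<open>f = log (P(y|x,z) / Q(y|z))\<close>, while the conditional mutual
  information is the expectation of \<open>g = log (P(y|x,z) / P(y|z))\<close>. Both \<open>g\<close> and \<open>f - g\<close> have the
  form \<open>- log r\<close> where \<open>r\<close> is a likelihood ratio with \<open>E[r] \<le> 1\<close>. Hence \<open>log r \<le> (r - 1) / ln b\<close>
  shows that \<open>g\<close> is integrable if \<open>f\<close> is, and that \<open>E[f - g] \<ge> 0\<close>.
\<close>

section \<open>Likelihood ratios of conditional distributions\<close>

lemma nn_integral_likelihood_ratio_le_1:
  fixes P :: "'a pmf" and A :: "'a \<Rightarrow> 'c" and B :: "'a \<Rightarrow> 'd" and C :: "'c \<Rightarrow> 'd pmf"
  shows "(\<integral>\<^sup>+\<omega>. ennreal (pmf (C (A \<omega>)) (B \<omega>) / \<P>(\<omega>' in measure_pmf P. B \<omega>' = B \<omega> \<bar> A \<omega>' = A \<omega>))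
    \<partial>measure_pmf P) \<le> 1"
proof -
  define J where "J = map_pmf (\<lambda>\<omega>. (A \<omega>, B \<omega>)) P"
  define M where "M = map_pmf A P"
  define R where "R t = pmf (C (fst t)) (snd t) / (pmf J t / pmf M (fst t))" for t
  have J: "pmf J (a, c) = measure (measure_pmf P) {\<omega>. B \<omega> = c \<and> A \<omega> = a}" for a c
    by (simp add: J_def pmf_map vimage_def conj_commute)
  have M: "pmf M a = measure (measure_pmf P) {\<omega>. A \<omega> = a}" for a
    by (simp add: M_def pmf_map vimage_def)
  have "(\<integral>\<^sup>+\<omega>. ennreal (pmf (C (A \<omega>)) (B \<omega>) / \<P>(\<omega>' in measure_pmf P. B \<omega>' = B \<omega> \<bar> A \<omega>' = A \<omega>))
    \<partial>measure_pmf P) = (\<integral>\<^sup>+t. ennreal (R t) \<partial>measure_pmf J)"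
    unfolding J_def nn_integral_map_pmf by (simp add: R_def J M cond_prob_def)
  also have "\<dots> = (\<integral>\<^sup>+t. ennreal (pmf J t) * ennreal (R t) \<partial>count_space UNIV)"
    by (rule nn_integral_measure_pmf)
  \<comment> \<open>Where \<open>pmf J t > 0\<close> the left integrand is exactly
    \<open>M(a) C(c|a)\<close>. Where \<open>pmf J t = 0\<close> it vanishes, while the right one
    may not; hence only an inequality.\<close>
  also have "\<dots> \<le> (\<integral>\<^sup>+t. ennreal (pmf M (fst t)) * ennreal (pmf (C (fst t)) (snd t)) \<partial>count_space UNIV)"
    by (intro nn_integral_mono)
       (auto simp: R_def simp flip: ennreal_mult intro!: ennreal_leI)
  also have "\<dots> = (\<integral>\<^sup>+a. \<integral>\<^sup>+c. ennreal (pmf M a) * ennreal (pmf (C a) c) \<partial>count_space UNIV \<partial>count_space UNIV)"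
    by (subst nn_integral_fst_count_space[symmetric]) simp
  also have "\<dots> = 1"
    by (simp add: nn_integral_cmult nn_integral_pmf_eq_1)
  finally show ?thesis .
qed

text \<open>Used with two choices of \<open>C\<close>: the conditional of \<open>Y\<close> after the
  cut, and the conditional of \<open>Y\<close> given \<open>Z\<close> alone.\<close>

lemma integrable_likelihood_ratio:
  fixes P :: "'a pmf" and A :: "'a \<Rightarrow> 'c" and B :: "'a \<Rightarrow> 'd" and C :: "'c \<Rightarrow> 'd pmf"
  defines "r \<equiv> \<lambda>\<omega>. pmf (C (A \<omega>)) (B \<omega>) / \<P>(\<omega>' in measure_pmf P. B \<omega>' = B \<omega> \<bar> A \<omega>' = A \<omega>)"
  shows "integrable (measure_pmf P) r" "measure_pmf.expectation P r \<le> 1"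
proof -
  have r: "r \<omega> \<ge> 0" for \<omega> by (simp add: r_def cond_prob_def)
  have le: "(\<integral>\<^sup>+\<omega>. ennreal (r \<omega>) \<partial>measure_pmf P) \<le> 1"
    unfolding r_def by (rule nn_integral_likelihood_ratio_le_1)
  then show int: "integrable (measure_pmf P) r"
    by (intro integrableI_nonneg) (auto simp: r order.strict_trans1)
  show "measure_pmf.expectation P r \<le> 1"
    using le by (subst (asm) nn_integral_eq_integral[OF int]) (auto simp: r)
qed

lemma log_le_minus_one_div:
  assumes "1 < b" "0 < x"
  shows "log b x \<le> (x - 1) / ln b"
  using assms ln_le_minus_one[of x] by (simp add: log_def divide_right_mono)

text \<open>Evaluating the density identity on the singleton \<open>{\<omega>}\<close> fixes the
  Radon-Nikodym derivative as a quotient of point masses.\<close>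

lemma entropy_density_pmf:
  assumes "absolutely_continuous (measure_pmf Q) (measure_pmf P)" "\<omega> \<in> set_pmf P"
  shows "pmf Q \<omega> > 0"
    and "entropy_density b (measure_pmf Q) (measure_pmf P) \<omega> = log b (pmf P \<omega> / pmf Q \<omega>)"
proof -
  let ?R = "RN_deriv (measure_pmf Q) (measure_pmf P)"
  have "measure_pmf P = density (measure_pmf Q) ?R"
    using measure_pmf.density_RN_deriv[OF assms(1)] by simp
  then have "emeasure (measure_pmf P) {\<omega>} = emeasure (density (measure_pmf Q) ?R) {\<omega>}"
    by simp
  then have eq: "ennreal (pmf P \<omega>) = ?R \<omega> * ennreal (pmf Q \<omega>)"
    by (simp add: emeasure_density emeasure_pmf_single)
  have P: "pmf P \<omega> > 0" using assms(2) by (simp add: pmf_positive)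
  \<comment> \<open>In \<open>ennreal\<close> anything times 0 is 0, even
    \<open>\<infinity>\<close>, so \<open>pmf Q \<omega> = 0\<close> would force
    \<open>pmf P \<omega> = 0\<close>.\<close>
  then show Q: "pmf Q \<omega> > 0"
    using eq by (metis ennreal_0 ennreal_eq_0_iff mult_zero_right not_less pmf_pos)
  have "pmf P \<omega> = enn2real (?R \<omega>) * pmf Q \<omega>"
    using arg_cong[OF eq, of enn2real] by (simp add: enn2real_mult)
  then show "entropy_density b (measure_pmf Q) (measure_pmf P) \<omega> = log b (pmf P \<omega> / pmf Q \<omega>)"
    using Q by (simp add: entropy_density_def)
qed

text \<open>For real series unconditional and absolute summability coincide, and the latter is
  integrability against the counting measure, of which \<open>measure_pmf p\<close> is a
  reweighting.\<close>

lemma summable_on_pmf_mult_iff: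
  fixes f :: "'a \<Rightarrow> real"
  shows "(\<lambda>x. pmf p x * f x) summable_on UNIV \<longleftrightarrow> integrable (measure_pmf p) f"
proof -
  have "(\<lambda>x. pmf p x * f x) summable_on UNIV \<longleftrightarrow>
      integrable (count_space UNIV) (\<lambda>x. pmf p x * f x)"
    unfolding summable_on_iff_abs_summable_on_real[of "\<lambda>x. pmf p x * f x"] abs_summable_equivalent
      Infinite_Set_Sum.abs_summable_on_def ..
  then show ?thesis
    by (simp add: measure_pmf_eq_density integrable_density)
qed

lemma infsum_pmf_mult:
  fixes f :: "'a \<Rightarrow> real"
  assumes "integrable (measure_pmf p) f"
  shows "(\<Sum>\<^sub>\<infinity>x. pmf p x * f x) = measure_pmf.expectation p f"
proof -
  have int: "integrable (count_space UNIV) (\<lambda>x. pmf p x * f x)"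
    using assms by (simp add: measure_pmf_eq_density integrable_density)
  have "(\<Sum>\<^sub>\<infinity>x. pmf p x * f x) = infsetsum (\<lambda>x. pmf p x * f x) UNIV"
    using int by (intro infsetsum_infsum[symmetric]) (simp add: Infinite_Set_Sum.abs_summable_on_def)
  also have "\<dots> = measure_pmf.expectation p f"
    by (simp add: infsetsum_def measure_pmf_eq_density integral_density)
  finally show ?thesis .
qed

text \<open>Rests on \<open>P(x,y|z) / (P(x|z) P(y|z)) = P(y|x,z) / P(y|z)\<close>, and on reading
  the sum over values as an expectation under the joint law of the three variables.\<close>

lemma cond_mutual_info_eq_expectation:
  fixes P :: "'a pmf" and X :: "'a \<Rightarrow> 'c" and Y :: "'a \<Rightarrow> 'd" and Z :: "'a \<Rightarrow> 'e"
    and b :: real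
  defines "g \<equiv> \<lambda>\<omega>. log b
    (\<P>(\<omega>' in measure_pmf P. Y \<omega>' = Y \<omega> \<bar> X \<omega>' = X \<omega> \<and> Z \<omega>' = Z \<omega>) /
     \<P>(\<omega>' in measure_pmf P. Y \<omega>' = Y \<omega> \<bar> Z \<omega>' = Z \<omega>))"
  assumes "integrable (measure_pmf P) g"
  shows "cond_mutual_info b P X Y Z = ereal (measure_pmf.expectation P g)"
proof -
  define T where "T \<omega> = (X \<omega>, Y \<omega>, Z \<omega>)" for \<omega>
  define G where "G = (\<lambda>(x, y, z). log b (\<P>(\<omega> in measure_pmf P. X \<omega> = x \<and> Y \<omega> = y \<bar> Z \<omega> = z) /
       (\<P>(\<omega> in measure_pmf P. X \<omega> = x \<bar> Z \<omega> = z) * \<P>(\<omega> in measure_pmf P. Y \<omega> = y \<bar> Z \<omega> = z))))"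
  have "pmf (map_pmf T P) (x, y, z) = \<P>(\<omega> in measure_pmf P. X \<omega> = x \<and> Y \<omega> = y \<and> Z \<omega> = z)"
    for x y z
    by (simp add: pmf_map T_def vimage_def)
  then have term_eq: "cond_mutual_info_term b P X Y Z = (\<lambda>t. pmf (map_pmf T P) t * G t)"
    by (auto simp: cond_mutual_info_term_def G_def fun_eq_iff)
  have eq: "G (T \<omega>) = g \<omega>" if "\<omega> \<in> set_pmf P" for \<omega>
  proof -
    \<comment> \<open>Allows the factors \<open>P(z)\<close> hidden in the conditional probabilities
      to be cancelled.\<close>
    have "measure (measure_pmf P) {\<omega>'. Z \<omega>' = Z \<omega>} > 0"
      by (rule measure_pmf_posI[OF that]) simp
    then show ?thesis
      by (simp add: G_def T_def g_def cond_prob_def conj_ac divide_simps)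
  qed
  have "integrable (measure_pmf P) (\<lambda>\<omega>. G (T \<omega>)) \<longleftrightarrow> integrable (measure_pmf P) g"
    by (intro integrable_cong_AE) (auto simp: AE_measure_pmf_iff eq)
  then have int: "integrable (measure_pmf (map_pmf T P)) G"
    using assms by simp
  have "measure_pmf.expectation P (\<lambda>\<omega>. G (T \<omega>)) = measure_pmf.expectation P g"
    by (intro integral_cong_AE) (auto simp: AE_measure_pmf_iff eq)
  then show ?thesis
    using int by (simp add: cond_mutual_info_def term_eq summable_on_pmf_mult_iff infsum_pmf_mult)
qed

section \<open>Factorizations before and after the cut\<close>

lemma cut_cond_no_parents:
  assumes "parents S j = {}"
  shows "cut_cond P K S j pa = K j pa"
  by (simp add: cut_cond_def assms)

text \<open>A single vanishing factor would make \<open>pmf P \<omega>\<close> vanish.\<close>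

lemma markovian_node_cond_pos:
  assumes "markovian E P" "\<omega> \<in> set_pmf P"
  shows "node_cond E P j (restrict \<omega> (parents E j)) (\<omega> j) > 0"
proof -
  have "pmf P \<omega> \<noteq> 0" using assms(2) by (simp add: set_pmf_iff)
  then have "node_cond E P j (restrict \<omega> (parents E j)) (\<omega> j) \<noteq> 0"
    using assms(1) by (simp add: markovian_def)
  then show ?thesis by (simp add: node_cond_def cond_prob_def order_less_le)
qed

lemma pmf_causal_conditionals:
  assumes "causal_conditionals E P K" "\<omega> \<in> set_pmf P"
  shows "pmf (K j (restrict \<omega> (parents E j))) v = node_cond E P j (restrict \<omega> (parents E j)) v"
proof -
  have "measure (measure_pmf P) {\<omega>'. restrict \<omega>' (parents E j) = restrict \<omega> (parents E j)} > 0"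
    by (rule measure_pmf_posI[OF assms(2)]) simp
  then show ?thesis using assms(1) by (simp add: causal_conditionals_def)
qed

lemma pmf_div_interventional_single_arrow:
  fixes E :: "('n::finite \<times> 'n) set"
  assumes "acyclic E" "markovian E P" "causal_conditionals E P K" "(X, Y) \<in> E" "\<omega> \<in> set_pmf P"
  shows "pmf P \<omega> / pmf (interventional E P K {(X, Y)}) \<omega> =
    node_cond E P Y (restrict \<omega> (parents E Y)) (\<omega> Y) /
      pmf (cut_cond P K {(X, Y)} Y (restrict \<omega> (parents E Y - {X}))) (\<omega> Y)"
    and "pmf (interventional E P K {(X, Y)}) \<omega> > 0 \<Longrightarrow>
      pmf (cut_cond P K {(X, Y)} Y (restrict \<omega> (parents E Y - {X}))) (\<omega> Y) > 0"
proof -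
  let ?N = "\<lambda>j. node_cond E P j (restrict \<omega> (parents E j)) (\<omega> j)"
  let ?C = "\<lambda>j. pmf (cut_cond P K {(X, Y)} j (restrict \<omega> (parents (E - {(X, Y)}) j))) (\<omega> j)"
  let ?c = "\<Prod>j\<in>UNIV - {Y}. ?N j"
  have parents_Y: "parents (E - {(X, Y)}) Y = parents E Y - {X}"
    by (auto simp: parents_def)
  \<comment> \<open>No arrow into such a \<open>j\<close> is cut, so its factor is given by
    \<open>K j\<close>, which agrees with \<open>node_cond\<close> at parent values of positive
    probability.\<close>
  have C: "?C j = ?N j" if "j \<noteq> Y" for j
  proof -
    have "parents {(X, Y)} j = {}" "parents (E - {(X, Y)}) j = parents E j"
      using that by (auto simp: parents_def)
    then show ?thesis
      by (simp add: cut_cond_no_parents pmf_causal_conditionals[OF assms(3,5)])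
  qed
  have "pmf P \<omega> = (\<Prod>j\<in>UNIV. ?N j)"
    using assms(2) by (simp add: markovian_def)
  also have "\<dots> = ?N Y * ?c"
    by (rule prod.remove) auto
  finally have P: "pmf P \<omega> = ?N Y * ?c" .
  have "pmf (interventional E P K {(X, Y)}) \<omega> = (\<Prod>j\<in>UNIV. ?C j)"
    by (rule pmf_interventional[OF assms(1)])
  also have "\<dots> = ?C Y * (\<Prod>j\<in>UNIV - {Y}. ?C j)"
    by (rule prod.remove) auto
  also have "(\<Prod>j\<in>UNIV - {Y}. ?C j) = ?c"
    by (rule prod.cong) (auto simp: C)
  finally have I: "pmf (interventional E P K {(X, Y)}) \<omega> = ?C Y * ?c" .
  \<comment> \<open>Positivity lets the common factor cancel in the quotient and carries the sign of
    the product over to the factor of \<open>Y\<close>.\<close>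
  have c: "?c > 0"
    by (intro prod_pos ballI markovian_node_cond_pos[OF assms(2,5)])
  show "pmf P \<omega> / pmf (interventional E P K {(X, Y)}) \<omega> =
    ?N Y / pmf (cut_cond P K {(X, Y)} Y (restrict \<omega> (parents E Y - {X}))) (\<omega> Y)"
    unfolding P I parents_Y using c by (intro mult_divide_mult_cancel_right) linarith
  show "pmf (cut_cond P K {(X, Y)} Y (restrict \<omega> (parents E Y - {X}))) (\<omega> Y) > 0"
    if "pmf (interventional E P K {(X, Y)}) \<omega> > 0"
    using that c by (simp add: I parents_Y zero_less_mult_iff)
qed

text \<open>As \<open>X\<close> is a parent of \<open>Y\<close>, fixing all parents means fixing
  \<open>X\<close> and the rest; this brings the conditional into the form
  \<open>P(y|x,z)\<close>.\<close>

lemma node_cond_split_parent: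
  assumes "(X, Y) \<in> E"
  shows "node_cond E P Y (restrict \<omega> (parents E Y)) v =
    \<P>(\<omega>' in measure_pmf P. \<omega>' Y = v \<bar>
      \<omega>' X = \<omega> X \<and> restrict \<omega>' (parents E Y - {X}) = restrict \<omega> (parents E Y - {X}))"
proof -
  have "restrict \<omega>' (parents E Y) = restrict \<omega> (parents E Y) \<longleftrightarrow>
    \<omega>' X = \<omega> X \<and> restrict \<omega>' (parents E Y - {X}) = restrict \<omega> (parents E Y - {X})" for \<omega>'
    using assms by (force simp: restrict_def fun_eq_iff parents_def)
  then show ?thesis by (simp add: node_cond_def)
qed

text \<open>Turns \<open>P(y|z)\<close> into an actual \<open>pmf\<close>, so that it can serve as
  \<open>C\<close> in \<open>integrable_likelihood_ratio\<close>.\<close>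

lemma cond_prob_as_pmf:
  assumes "\<omega> \<in> set_pmf P"
  shows "pmf (map_pmf Y (cond_pmf P {\<omega>'. Z \<omega>' = Z \<omega>})) y =
    \<P>(\<omega>' in measure_pmf P. Y \<omega>' = y \<bar> Z \<omega>' = Z \<omega>)"
proof -
  have ne: "set_pmf P \<inter> {\<omega>'. Z \<omega>' = Z \<omega>} \<noteq> {}" using assms by auto
  have "emeasure (measure_pmf P) {\<omega>'. Z \<omega>' = Z \<omega>} \<noteq> 0"
    using ne by (rule emeasure_measure_pmf_not_zero)
  then have "measure (measure_pmf (cond_pmf P {\<omega>'. Z \<omega>' = Z \<omega>})) {\<omega>'. Y \<omega>' = y} =
    measure (measure_pmf P) ({\<omega>'. Z \<omega>' = Z \<omega>} \<inter> {\<omega>'. Y \<omega>' = y}) /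
      measure (measure_pmf P) {\<omega>'. Z \<omega>' = Z \<omega>}"
    unfolding cond_pmf.rep_eq[OF ne] by (intro measure_uniform_measure) auto
  then show ?thesis
    by (simp add: pmf_map vimage_def cond_prob_def Int_def conj_commute)
qed

theorem mainTheorem2:
  fixes E :: "('n::finite \<times> 'n) set"
    and P :: "('n \<Rightarrow> 'v) pmf"
    and K :: "'n \<Rightarrow> ('n \<Rightarrow> 'v) \<Rightarrow> 'v pmf"
    and b :: real and X Y :: 'n
  assumes "1 < b"
    and "acyclic E"
    and "markovian E P"
    and "causal_conditionals E P K"
    and "(X, Y) \<in> E"
  shows "causal_strength b E P K {(X, Y)} \<ge>
    cond_mutual_info b P (\<lambda>\<omega>. \<omega> X) (\<lambda>\<omega>. \<omega> Y) (\<lambda>\<omega>. restrict \<omega> (parents E Y - {X}))"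
proof -
  define Q where "Q = interventional E P K {(X, Y)}"
  define f where "f = entropy_density b (measure_pmf Q) (measure_pmf P)"
  show ?thesis
  proof (cases "absolutely_continuous (measure_pmf Q) (measure_pmf P) \<and> integrable (measure_pmf P) f")
    \<comment> \<open>The causal strength is \<open>\<infinity>\<close> by definition here.\<close>
    case False
    then show ?thesis
      by (auto simp: causal_strength_def relative_entropy_def Q_def f_def)
  next
    case True
    then have ac: "absolutely_continuous (measure_pmf Q) (measure_pmf P)"
      and int_f: "integrable (measure_pmf P) f" by auto
    define Z where "Z \<omega> = restrict \<omega> (parents E Y - {X})" for \<omega> :: "'n \<Rightarrow> 'v"
    \<comment> \<open>At \<open>\<omega>\<close>, \<open>pxz\<close> is \<open>P(y|x,z)\<close>,
      \<open>pz\<close> is \<open>P(y|z)\<close> and \<open>q\<close> is the conditional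
      \<open>Q(y|z)\<close> after the cut.\<close>
    define pxz where "pxz \<omega> = \<P>(\<omega>' in measure_pmf P. \<omega>' Y = \<omega> Y \<bar> \<omega>' X = \<omega> X \<and> Z \<omega>' = Z \<omega>)" for \<omega>
    define pz where "pz \<omega> = \<P>(\<omega>' in measure_pmf P. \<omega>' Y = \<omega> Y \<bar> Z \<omega>' = Z \<omega>)" for \<omega>
    define q where "q \<omega> = pmf (cut_cond P K {(X, Y)} Y (Z \<omega>)) (\<omega> Y)" for \<omega>
    define g where "g \<omega> = log b (pxz \<omega> / pz \<omega>)" for \<omega>
    have pos: "pxz \<omega> > 0" "pz \<omega> > 0" "q \<omega> > 0" if "\<omega> \<in> set_pmf P" for \<omega>
    proof -
      show "pxz \<omega> > 0"
        using markovian_node_cond_pos[OF assms(3) that, of Y]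
        unfolding pxz_def Z_def node_cond_split_parent[OF assms(5)] .
      show "pz \<omega> > 0"
        unfolding pz_def cond_prob_def
        by (intro divide_pos_pos measure_pmf_posI[OF that]) auto
      show "q \<omega> > 0"
        using pmf_div_interventional_single_arrow(2)[OF assms(2-5) that]
          entropy_density_pmf(1)[OF ac that]
        by (simp add: q_def Z_def Q_def)
    qed
    have f: "f \<omega> = log b (pxz \<omega> / q \<omega>)" if "\<omega> \<in> set_pmf P" for \<omega>
      using entropy_density_pmf(2)[OF ac that, of b]
        pmf_div_interventional_single_arrow(1)[OF assms(2-5) that]
      by (simp add: f_def Q_def q_def pxz_def Z_def node_cond_split_parent[OF assms(5)])
    have int_q: "integrable (measure_pmf P) (\<lambda>\<omega>. q \<omega> / pz \<omega>)"
      and le_q: "measure_pmf.expectation P (\<lambda>\<omega>. q \<omega> / pz \<omega>) \<le> 1"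
      unfolding q_def pz_def
      by (rule integrable_likelihood_ratio[where C = "cut_cond P K {(X, Y)} Y"])+
    \<comment> \<open>The conditioning variable is now the pair of \<open>X\<close> and
      \<open>Z\<close>, but \<open>C\<close> ignores the value of \<open>X\<close>.\<close>
    have "integrable (measure_pmf P)
      (\<lambda>\<omega>. pmf (map_pmf (\<lambda>\<omega>'. \<omega>' Y) (cond_pmf P {\<omega>'. Z \<omega>' = Z \<omega>})) (\<omega> Y) / pxz \<omega>)"
      using integrable_likelihood_ratio(1)[where P = P and A = "\<lambda>\<omega>. (\<omega> X, Z \<omega>)"
          and B = "\<lambda>\<omega>. \<omega> Y"
          and C = "\<lambda>(x, z). map_pmf (\<lambda>\<omega>'. \<omega>' Y) (cond_pmf P {\<omega>'. Z \<omega>' = z})"]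
      by (simp add: pxz_def)
    \<comment> \<open>The numerator is identified with \<open>pz\<close> on the support of
      \<open>P\<close>, which suffices almost everywhere.\<close>
    moreover have "integrable (measure_pmf P)
        (\<lambda>\<omega>. pmf (map_pmf (\<lambda>\<omega>'. \<omega>' Y) (cond_pmf P {\<omega>'. Z \<omega>' = Z \<omega>})) (\<omega> Y) / pxz \<omega>) \<longleftrightarrow>
      integrable (measure_pmf P) (\<lambda>\<omega>. pz \<omega> / pxz \<omega>)"
      by (intro integrable_cong_AE) (auto simp: AE_measure_pmf_iff cond_prob_as_pmf pz_def)
    ultimately have int_p: "integrable (measure_pmf P) (\<lambda>\<omega>. pz \<omega> / pxz \<omega>)"
      by blast
    have lower: "- ((pz \<omega> / pxz \<omega> - 1) / ln b) \<le> g \<omega>" if "\<omega> \<in> set_pmf P" for \<omega>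
    proof -
      have "g \<omega> = - log b (pz \<omega> / pxz \<omega>)"
        using pos[OF that] assms(1) by (simp add: g_def log_divide)
      then show ?thesis
        using log_le_minus_one_div[OF assms(1), of "pz \<omega> / pxz \<omega>"] pos[OF that] by simp
    qed
    have upper: "g \<omega> \<le> f \<omega> + (q \<omega> / pz \<omega> - 1) / ln b" if "\<omega> \<in> set_pmf P" for \<omega>
    proof -
      have "g \<omega> = f \<omega> + log b (q \<omega> / pz \<omega>)"
        using pos[OF that] assms(1) by (simp add: g_def f[OF that] log_divide)
      then show ?thesis
        using log_le_minus_one_div[OF assms(1), of "q \<omega> / pz \<omega>"] pos[OF that] by simp
    qed
    have int_lower: "integrable (measure_pmf P) (\<lambda>\<omega>. - ((pz \<omega> / pxz \<omega> - 1) / ln b))"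
      using int_p by simp
    have int_q': "integrable (measure_pmf P) (\<lambda>\<omega>. (q \<omega> / pz \<omega> - 1) / ln b)"
      using int_q by simp
    have int_upper: "integrable (measure_pmf P) (\<lambda>\<omega>. f \<omega> + (q \<omega> / pz \<omega> - 1) / ln b)"
      using int_f int_q' by (rule Bochner_Integration.integrable_add)
    \<comment> \<open>Between two integrable bounds, \<open>\<bar>g\<bar>\<close> is at most the sum
      of their absolute values. Without integrability the conditional mutual information would be
      \<open>\<infinity>\<close> by definition.\<close>
    have int_g: "integrable (measure_pmf P) g"
    proof (rule Bochner_Integration.integrable_bound)
      show "integrable (measure_pmf P) (\<lambda>\<omega>. \<bar>- ((pz \<omega> / pxz \<omega> - 1) / ln b)\<bar> +
          \<bar>f \<omega> + (q \<omega> / pz \<omega> - 1) / ln b\<bar>)"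
        by (intro Bochner_Integration.integrable_add integrable_abs int_lower int_upper)
      show "AE \<omega> in measure_pmf P. norm (g \<omega>) \<le> norm (\<bar>- ((pz \<omega> / pxz \<omega> - 1) / ln b)\<bar> +
          \<bar>f \<omega> + (q \<omega> / pz \<omega> - 1) / ln b\<bar>)"
      proof (rule AE_pmfI)
        fix \<omega> assume "\<omega> \<in> set_pmf P"
        then show "norm (g \<omega>) \<le> norm (\<bar>- ((pz \<omega> / pxz \<omega> - 1) / ln b)\<bar> +
          \<bar>f \<omega> + (q \<omega> / pz \<omega> - 1) / ln b\<bar>)"
          using lower[of \<omega>] upper[of \<omega>] unfolding real_norm_def by linarith
      qed
    qed simp
    have "measure_pmf.expectation P g \<le>
      measure_pmf.expectation P (\<lambda>\<omega>. f \<omega> + (q \<omega> / pz \<omega> - 1) / ln b)"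
      by (intro integral_mono_AE int_g int_upper AE_pmfI upper)
    also have "\<dots> = measure_pmf.expectation P f +
        (measure_pmf.expectation P (\<lambda>\<omega>. q \<omega> / pz \<omega>) - 1) / ln b"
      using int_f int_q int_q' by simp
    \<comment> \<open>The correction term is nonpositive because \<open>E[q / pz] \<le> 1\<close>
      and \<open>ln b > 0\<close>.\<close>
    also have "\<dots> \<le> measure_pmf.expectation P f"
      using le_q assms(1) by (simp add: divide_le_0_iff)
    finally have "measure_pmf.expectation P g \<le> measure_pmf.expectation P f" .
    moreover have "causal_strength b E P K {(X, Y)} = ereal (measure_pmf.expectation P f)"
      using True by (simp add: causal_strength_def relative_entropy_def KL_divergence_def Q_def f_def)
    moreover have "cond_mutual_info b P (\<lambda>\<omega>. \<omega> X) (\<lambda>\<omega>. \<omega> Y) Z = ereal (measure_pmf.expectation P g)"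
      using cond_mutual_info_eq_expectation[where P = P and b = b
          and X = "\<lambda>\<omega>. \<omega> X" and Y = "\<lambda>\<omega>. \<omega> Y" and Z = Z] int_g
      by (simp add: g_def[abs_def] pxz_def pz_def)
    ultimately show ?thesis by (simp flip: Z_def[abs_def])
  qed
qed

end
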